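(* Let $f$ be a convex function and $x_0\in\operatorname{dom} f$. Denote $K=\{x: f(x)\le f(x_0)\}$ and assume that $f\in\mathcal{H}_{2,L}\cap\mathcal{L}_{r,\mu}(K)$. Put $\kappa = L/\mu^{2/r}$, $\tau = 1-2/r\in[0,1)$, $c=4e^{2/e}$ and $C^*_{\kappa,\tau} = e^{1-\tau}(c\kappa)^{1/2}(f(x_0)-f^* )^{-\tau/2}$, and denote by $N\ge 2C^*_{\kappa,\tau}$ a given number of iterations. Run the schemes $\mathcal{S}_{i,j}$ (defined in the context) from $x_0$ to minimize $f$, for $i\in\{1,\dots,\lfloor\log_2 N\rfloor\}$ and $j\in\{0,\dots,\lceil\log_2 N\rceil\}$, stopping each time after $N$ total inner algorithm iterations, i.e. at the smallest $R$ such that $\sum_{k=1}^R t_k\ge N$, with output $\hat x=x_R$. If $\tau=0$, there exists $i\in\{1,\dots,\lfloor\log_2 N\rfloor\}$ such that the scheme $\mathcal{S}_{i,0}$ achieves a precision given by $$f(\hat x)-f^*\le \exp\left(-e^{-1}(c\kappa)^{-1/2}N\right)(f(x_0)-f^* ).$$ If $\tau>0$, there exist $i\in\{1,\dots,\lfloor\log_2 N\rfloor\}$ and $j\in\{0,\dots,\lceil\log_2 N\rceil\}$ such that the scheme $\mathcal{S}_{i,j}$ achieves a precision given by $$f(\hat x)-f^*\le \frac{f(x_0)-f^*}{\left(\tau e^{-1}(c\kappa)^{-1/2}(f(x_0)-f^* )^{\tau/2}(N-1)/4+1\right)^{2/\tau}}.$$ Overall, running the logarithmic grid search has a complexity $(\log_2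 N)^2$ times higher than running $N$ iterations using the optimal (oracle) scheme.
   Context: $f$ is defined on $\mathbb{R}^n$; $X^*$ is its set of minimizers and $f^*$ its minimum. $L>0$, $\mu>0$, $r\ge1$ are constants. $\mathcal{H}_{2,L}$ is the set of functions $f$ with $\|\nabla f(x)-\nabla f(y)\|_2\le L\|x-y\|_2$ for all $x,y\in\operatorname{dom} f$ and any subgradients $\nabla f(x)\in\partial f(x)$, $\nabla f(y)\in\partial f(y)$. $\mathcal{L}_{r,\mu}(K)$ is the set of functions $f$ satisfying the Łojasiewicz growth condition $\frac{\mu}{r}d(x,X^* )^r\le f(x)-f^*$ for every $x\in K$, where $d(x,X^* )=\min_{y\in X^*}\|x-y\|_2$. $\mathcal{A}$ denotes Nesterov's accelerated gradient method with monotone objective values: given a starting point $x$ and a number of (inner) iterations $t$ it outputs a point $\mathcal{A}(x,t)$ such that $f(\mathcal{A}(x,t))-f^*\le \frac{4L}{t^2}d(x,X^* )^2$ and $f(\mathcal{A}(x,t))\le f(x)$. Iteration counts $t_k$ are treated as real numbers (rounding to integers is ignored). Scheme $\mathcal{S}_{i,j}$: with $C_i=2^i$ and $\tau_j=2^{-j}$, iterate $x_k=\mathcal{A}(x_{k-1},t_k)$ for $k=1,2,\dots$ from $x_0$, with $t_k=C_i$ if $j=0$, and $t_k=C_ie^{\tau_j k}$ if $j\ge 1$. The optimal (oracle) scheme is the same restart scheme $x_k=\mathcal{A}(x_{k-1},t_k)$ with the schedule $t_k=C^*_{\kappa,\tau}e^{\tau k}$, which requires knowledge of $\kappa$ and $\tau$.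 *)

theory Defs
  imports "HOL-Analysis.Analysis" "HOL-Library.Landau_Symbols"
begin

(* Functions are finite on all of R^n, so dom f is the whole space. *)

definition minimizers :: "(real ^ 'n \<Rightarrow> real) \<Rightarrow> (real ^ 'n) set" where
  "minimizers f = {x. \<forall>y. f x \<le> f y}"

definition min_value :: "(real ^ 'n \<Rightarrow> real) \<Rightarrow> real" where
  "min_value f = (INF x. f x)"

definition subdifferential :: "(real ^ 'n \<Rightarrow> real) \<Rightarrow> real ^ 'n \<Rightarrow> (real ^ 'n) set" where
  "subdifferential f x = {g. \<forall>y. f x + g \<bullet> (y - x) \<le> f y}"

definition smooth_class :: "real \<Rightarrow> (real ^ 'n \<Rightarrow> real) set" where
  "smooth_class L = {f. \<forall>x y. \<forall>g \<in> subdifferential f x. \<forall>h \<in> subdifferential f y.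
     norm (g - h) \<le> L * norm (x - y)}"

(* infdist x {} = 0, so this is meaningful only for functions that attain their minimum;
   the minimum defining d(x, X* ) is then attained for continuous f, and equals infdist. *)
definition lojasiewicz_class ::
  "real \<Rightarrow> real \<Rightarrow> (real ^ 'n) set \<Rightarrow> (real ^ 'n \<Rightarrow> real) set" where
  "lojasiewicz_class r \<mu> K =
     {f. \<forall>x \<in> K. \<mu> / r * infdist x (minimizers f) powr r \<le> f x - min_value f}"

(* The accelerated method enters only through its guarantees: A x t is the point returned
   after t inner iterations from x. Iteration counts are (positive) real numbers. *)
definition monotone_accelerated_method ::
  "real \<Rightarrow> (real ^ 'n \<Rightarrow> real) \<Rightarrow> (real ^ 'n \<Rightarrow> real \<Rightarrow> real ^ 'n) \<Rightarrow> bool" where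
  "monotone_accelerated_method L f A \<longleftrightarrow>
     (\<forall>x t. 0 < t \<longrightarrow>
        f (A x t) - min_value f \<le> 4 * L / t\<^sup>2 * (infdist x (minimizers f))\<^sup>2 \<and>
        f (A x t) \<le> f x)"

(* The schedule t is indexed from 1; its value at 0 is never used. *)
primrec restart ::
  "('a \<Rightarrow> real \<Rightarrow> 'a) \<Rightarrow> (nat \<Rightarrow> real) \<Rightarrow> 'a \<Rightarrow> nat \<Rightarrow> 'a" where
  "restart A t x0 0 = x0"
| "restart A t x0 (Suc k) = A (restart A t x0 k) (t (Suc k))"

definition stop_index :: "(nat \<Rightarrow> real) \<Rightarrow> real \<Rightarrow> nat" where
  "stop_index t N = (LEAST R. N \<le> (\<Sum>k=1..R. t k))"

definition restart_output ::
  "('a \<Rightarrow> real \<Rightarrow> 'a) \<Rightarrow> (nat \<Rightarrow> real) \<Rightarrow> 'a \<Rightarrow> real \<Rightarrow> 'a" where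
  "restart_output A t x0 N = restart A t x0 (stop_index t N)"

(* Inner iterations actually performed: at least N, as the last restart is completed. *)
definition inner_iterations :: "(nat \<Rightarrow> real) \<Rightarrow> real \<Rightarrow> real" where
  "inner_iterations t N = (\<Sum>k=1..stop_index t N. t k)"

definition grid_schedule :: "nat \<Rightarrow> nat \<Rightarrow> nat \<Rightarrow> real" where
  "grid_schedule i j k =
     (if j = 0 then 2 ^ i else 2 ^ i * exp (2 powr (- real j) * real k))"

definition oracle_schedule :: "real \<Rightarrow> real \<Rightarrow> nat \<Rightarrow> real" where
  "oracle_schedule C \<tau> k = C * exp (\<tau> * real k)"

definition grid_i :: "real \<Rightarrow> nat set" where
  "grid_i N = {1..nat \<lfloor>log 2 N\<rfloor>}"

definition grid_j :: "real \<Rightarrow> nat set" where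
  "grid_j N = {0..nat \<lceil>log 2 N\<rceil>}"

definition grid_search_cost :: "real \<Rightarrow> real" where
  "grid_search_cost N =
     (\<Sum>i\<in>grid_i N. \<Sum>j\<in>grid_j N. inner_iterations (grid_schedule i j) N)"

end

theory Submission
  imports Defs "HOL-Real_Asymp.Real_Asymp"
begin

text \<open>Write \<open>\<delta>\<close> for the initial gap and \<open>D = C / exp (1 - \<tau>)\<close>. The guarantee of the method and the
  growth condition give the gap recursion \<open>g (k + 1) \<le> D\<^sup>2 * \<delta> powr \<tau> * g k powr (1 - \<tau>) / (t (k + 1))\<^sup>2\<close>.
  Hence the gap decays like \<open>exp (- 2 \<rho> k)\<close> under the schedule \<open>T exp (\<sigma> k)\<close> as soon as \<open>T \<ge> C\<close>, \<open>\<rho> \<le> 1\<close> and \<open>\<rho> \<tau> \<le> \<sigma>\<close>. On the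
  grid there is a \<open>T\<close> within a factor 2 of \<open>C\<close>, and either a \<open>\<sigma>\<close> within a factor 2 below \<open>\<tau>\<close> (take
  \<open>\<rho> = \<sigma> / \<tau>\<close>), or, if \<open>\<tau>\<close> is smaller than every grid value, a \<open>\<sigma> \<le> 1 / N\<close> above \<open>\<tau>\<close>, for which the
  schedule is constant up to a factor 2 (take \<open>\<rho> = 1\<close>).

  Smoothness gives \<open>f x - f\<^sup>* \<le> L d(x, X\<^sup>* )\<^sup>2\<close>, which is compatible with the growth condition near
  \<open>X\<^sup>*\<close> only if \<open>r \<ge> 2\<close>, and which forces \<open>D \<ge> 2\<close>, so that the grid reaches down to \<open>C\<close>.

  A grid run overshoots its budget by at most \<open>2 \<sigma> N + 3 T\<close>, and these geometric progressions add up
  to only \<open>O(N log N)\<close> over the grid.\<close>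

section \<open>Convexity, smoothness and the range of the growth exponent\<close>

text \<open>Membership in \<open>smooth_class\<close> only compares existing subgradients, so it
  yields a bound at a point only once a subgradient is known there. A hyperplane separating
  \<open>(x, f x)\<close> from the strict epigraph provides one, because it cannot be
  vertical.\<close>

lemma subdifferential_nonempty:
  fixes f :: "real ^ 'n \<Rightarrow> real"
  assumes "convex_on UNIV f"
  shows "subdifferential f x \<noteq> {}"
proof -
  define T where "T = {p :: (real ^ 'n) \<times> real. f (fst p) < snd p}"
  have "convex T"
    unfolding T_def convex_def
  proof (clarsimp)
    fix a c :: "real ^ 'n" and b d u v :: real
    assume h: "f a < b" "f c < d" "0 \<le> u" "0 \<le> v" "u + v = 1"
    have "f (u *\<^sub>R a + v *\<^sub>R c) \<le> u * f a + v * f c"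
      using assms h unfolding convex_on_def by auto
    also have "\<dots> < u * b + v * d"
    proof (cases "u = 0")
      case True
      then show ?thesis using h by simp
    next
      case False
      then have "u * f a < u * b" "v * f c \<le> v * d"
        using h by (auto intro: mult_left_mono)
      then show ?thesis by linarith
    qed
    finally show "f (u *\<^sub>R a + v *\<^sub>R c) < u * b + v * d" .
  qed
  moreover have "(x, f x + 1) \<in> T" by (simp add: T_def)
  moreover have "{(x, f x)} \<inter> T = {}" by (auto simp: T_def)
  ultimately have "\<exists>p b. p \<noteq> 0 \<and> (\<forall>q\<in>{(x, f x)}. p \<bullet> q \<le> b) \<and> (\<forall>q\<in>T. b \<le> p \<bullet> q)"
    by (intro separating_hyperplane_sets) auto
  then obtain p b where p: "p \<noteq> 0" "p \<bullet> (x, f x) \<le> b" "\<And>q. q \<in> T \<Longrightarrow> b \<le> p \<bullet> q"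
    by blast
  obtain u s where us: "p = (u, s)" by (cases p)
  have sep: "u \<bullet> x + s * f x \<le> u \<bullet> y + s * t" if "f y < t" for y t
    using p(2) p(3)[of "(y, t)"] that by (auto simp: us T_def inner_Pair)
  have "0 \<le> s"
    using sep[of x "f x + 1"] by (simp add: algebra_simps)
  \<comment> \<open>If \<open>s = 0\<close>, the hyperplane bounds the domain from one side; the
    point \<open>x - u\<close>, where \<open>f\<close> is finite too, lies beyond it.\<close>
  moreover have "s \<noteq> 0"
  proof
    assume "s = 0"
    then have "u \<bullet> x \<le> u \<bullet> (x - u)"
      using sep[of "x - u" "f (x - u) + 1"] by simp
    then have "u \<bullet> u \<le> 0" by (simp add: inner_diff_right)
    then have "u = 0"
      by (meson inner_ge_zero inner_eq_zero_iff order_antisym)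
    with \<open>s = 0\<close> p(1) us show False by (simp add: zero_prod_def)
  qed
  ultimately have "0 < s" by simp
  have "f x + (- (1 / s)) *\<^sub>R u \<bullet> (y - x) \<le> f y" for y
  proof (rule field_le_epsilon)
    fix e :: real
    assume "0 < e"
    then have "u \<bullet> x + s * f x \<le> u \<bullet> y + s * (f y + e)"
      by (intro sep) simp
    then show "f x + (- (1 / s)) *\<^sub>R u \<bullet> (y - x) \<le> f y + e"
      using \<open>0 < s\<close> by (simp add: field_simps inner_diff_right)
  qed
  then have "(- (1 / s)) *\<^sub>R u \<in> subdifferential f x"
    by (simp add: subdifferential_def)
  then show ?thesis by blast
qed

lemma min_value_eq: "y \<in> minimizers f \<Longrightarrow> min_value f = f y"
  unfolding min_value_def minimizers_def
  by (rule cInf_eq_minimum) auto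

lemma min_value_le: "minimizers f \<noteq> {} \<Longrightarrow> min_value f \<le> f x"
  using min_value_eq by (fastforce simp: minimizers_def)

text \<open>Zero is a subgradient at a minimizer \<open>y\<close>, so a subgradient at
  \<open>x\<close> has norm at most \<open>L * norm (x - y)\<close>; the subgradient inequality and
  Cauchy-Schwarz do the rest.\<close>

lemma smooth_gap_le:
  fixes f :: "real ^ 'n \<Rightarrow> real"
  assumes "0 < L" "convex_on UNIV f" "minimizers f \<noteq> {}" "f \<in> smooth_class L"
  shows "f x - min_value f \<le> L * (infdist x (minimizers f))\<^sup>2"
proof -
  have gap: "f x - min_value f \<le> L * (dist x y)\<^sup>2" if y: "y \<in> minimizers f" for y
  proof -
    obtain g where g: "g \<in> subdifferential f x"
      using subdifferential_nonempty[OF assms(2)] by blast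
    have "0 \<in> subdifferential f y"
      using y by (auto simp: subdifferential_def minimizers_def)
    then have "norm g \<le> L * norm (x - y)"
      using assms(4) g by (force simp: smooth_class_def)
    have "f x + g \<bullet> (y - x) \<le> f y"
      using g by (simp add: subdifferential_def)
    then have "f x - min_value f \<le> g \<bullet> (x - y)"
      by (simp add: min_value_eq[OF y] inner_diff_right)
    also have "\<dots> \<le> norm g * norm (x - y)"
      by (rule norm_cauchy_schwarz)
    also have "\<dots> \<le> L * norm (x - y) * norm (x - y)"
      using \<open>norm g \<le> _\<close> by (rule mult_right_mono) simp
    finally show ?thesis by (simp add: dist_norm power2_eq_square)
  qed
  \<comment> \<open>After taking roots the bound passes from each minimizer to the infimum, without
    a nearest minimizer.\<close>
  have "sqrt ((f x - min_value f) / L) \<le> infdist x (minimizers f)"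
    unfolding infdist_notempty[OF assms(3)]
  proof (rule cINF_greatest[OF assms(3)])
    fix y assume "y \<in> minimizers f"
    then show "sqrt ((f x - min_value f) / L) \<le> dist x y"
      using gap[of y] assms(1) by (intro real_le_lsqrt) (auto simp: field_simps)
  qed
  then have "(f x - min_value f) / L \<le> (infdist x (minimizers f))\<^sup>2"
    by (rule sqrt_le_D)
  then show ?thesis using assms(1) by (simp add: field_simps)
qed

text \<open>At distance \<open>e\<close> from the minimizers, growth and smoothness give
  \<open>\<mu> / r * e powr r \<le> L * e\<^sup>2\<close>, which fails for small \<open>e\<close> if
  \<open>r < 2\<close>. The segment from a minimizer to \<open>x0\<close> stays in the sublevel set
  and supplies such a point.\<close>

lemma lojasiewicz_exponent_ge_2:
  fixes f :: "real ^ 'n \<Rightarrow> real"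
  assumes "0 < L" "0 < \<mu>" "1 \<le> r" "convex_on UNIV f" "minimizers f \<noteq> {}"
    and "min_value f < f x0"
    and "f \<in> smooth_class L" "f \<in> lojasiewicz_class r \<mu> {x. f x \<le> f x0}"
  shows "2 \<le> r"
proof (rule ccontr)
  assume "\<not> 2 \<le> r"
  then have "r < 2" by simp
  let ?d = "\<lambda>x. infdist x (minimizers f)"
  obtain y where y: "y \<in> minimizers f" using assms(5) by blast
  have "?d x0 \<noteq> 0"
    using smooth_gap_le[OF assms(1,4,5,7), of x0] assms(6) by auto
  then have d0: "0 < ?d x0" using infdist_nonneg[of x0 "minimizers f"] by linarith
  \<comment> \<open>The second term makes \<open>e powr (2 - r)\<close> at most half of
    \<open>\<mu> / (r * L)\<close>, for a strict contradiction; the first keeps \<open>e\<close>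
    among the distances met on the segment.\<close>
  define e where "e = min (?d x0) ((\<mu> / (2 * r * L)) powr (1 / (2 - r)))"
  have e: "0 < e" "e \<le> ?d x0"
    using d0 assms by (auto simp: e_def)
  have "\<exists>s\<ge>0. s \<le> 1 \<and> ?d (y + s *\<^sub>R (x0 - y)) = e"
    using y e by (intro IVT') (auto intro!: continuous_intros)
  then obtain s where s: "0 \<le> s" "s \<le> 1" "?d (y + s *\<^sub>R (x0 - y)) = e" by blast
  define x where "x = y + s *\<^sub>R (x0 - y)"
  have "x = (1 - s) *\<^sub>R y + s *\<^sub>R x0" by (simp add: x_def algebra_simps)
  then have "f x \<le> (1 - s) * f y + s * f x0"
    using assms(4) s unfolding convex_on_def by (simp del: One_nat_def)
  also have "\<dots> \<le> (1 - s) * f x0 + s * f x0"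
    using y s by (intro add_mono mult_left_mono) (auto simp: minimizers_def)
  finally have "f x \<le> f x0" by (simp add: algebra_simps)
  then have "\<mu> / r * e powr r \<le> f x - min_value f"
    using assms(8) s(3) by (auto simp: lojasiewicz_class_def x_def)
  also have "\<dots> \<le> L * e\<^sup>2"
    using smooth_gap_le[OF assms(1,4,5,7), of x] s(3) by (simp add: x_def)
  also have "e\<^sup>2 = e powr r * e powr (2 - r)"
    using e by (simp flip: powr_add)
  finally have "\<mu> / r * e powr r \<le> L * e powr (2 - r) * e powr r"
    by (simp add: mult_ac)
  then have "\<mu> / r \<le> L * e powr (2 - r)"
    using e by (simp only: mult_le_cancel_right) auto
  moreover have "e powr (2 - r) \<le> ((\<mu> / (2 * r * L)) powr (1 / (2 - r))) powr (2 - r)"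
    using e \<open>r < 2\<close> by (intro powr_mono2) (auto simp: e_def)
  moreover have "\<dots> = \<mu> / (2 * r * L)"
    using \<open>r < 2\<close> assms by (simp add: powr_powr)
  ultimately have "\<mu> / r \<le> L * (\<mu> / (2 * r * L))"
    using assms(1) by (smt (verit) mult_left_mono)
  then show False using assms by (simp add: field_simps)
qed

section \<open>The growth condition as a bound on the distance\<close>

text \<open>The quotient \<open>ln r / r\<close> is largest at \<open>r = exp 1\<close>, by the
  tangent of \<open>ln\<close> there. This is the origin of the factor
  \<open>exp (2 / exp 1)\<close> in \<open>c\<close>.\<close>

lemma powr_inverse_le_exp:
  fixes r :: real
  assumes "0 < r"
  shows "r powr (2 / r) \<le> exp (2 / exp 1)"
proof -
  have "ln (r / exp 1) \<le> r / exp 1 - 1"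
    using assms by (intro ln_le_minus_one) simp
  then have "ln r \<le> r / exp 1"
    using assms by (simp add: ln_div)
  then have "2 / r * ln r \<le> 2 / r * (r / exp 1)"
    using assms by (intro mult_left_mono) auto
  then show ?thesis using assms by (simp add: powr_def)
qed

lemma lojasiewicz_infdist_le:
  fixes f :: "real ^ 'n \<Rightarrow> real"
  assumes "0 < L" "0 < \<mu>" "1 \<le> r"
    and "f \<in> lojasiewicz_class r \<mu> K" "x \<in> K"
  shows "L * (infdist x (minimizers f))\<^sup>2
    \<le> exp (2 / exp 1) * (L / \<mu> powr (2 / r)) * (f x - min_value f) powr (2 / r)"
proof -
  let ?d = "infdist x (minimizers f)"
  have d: "0 \<le> ?d" by (rule infdist_nonneg)
  have loj: "\<mu> / r * ?d powr r \<le> f x - min_value f"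
    using assms by (auto simp: lojasiewicz_class_def)
  have nn: "0 \<le> f x - min_value f"
    by (rule order_trans[OF _ loj]) (use assms in auto)
  have "?d powr r \<le> r / \<mu> * (f x - min_value f)"
    using loj assms by (simp add: field_simps)
  then have "(?d powr r) powr (2 / r) \<le> (r / \<mu> * (f x - min_value f)) powr (2 / r)"
    using assms by (intro powr_mono2) auto
  moreover have "(?d powr r) powr (2 / r) = ?d\<^sup>2"
    using d assms by (cases "?d = 0") (auto simp: powr_powr)
  ultimately have "?d\<^sup>2 \<le> r powr (2 / r) / \<mu> powr (2 / r) * (f x - min_value f) powr (2 / r)"
    using assms nn by (simp add: powr_mult powr_divide)
  also have "\<dots> \<le> exp (2 / exp 1) / \<mu> powr (2 / r) * (f x - min_value f) powr (2 / r)"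
    using assms by (intro mult_right_mono divide_right_mono powr_inverse_le_exp) auto
  finally have "L * ?d\<^sup>2 \<le> L * (exp (2 / exp 1) / \<mu> powr (2 / r) * (f x - min_value f) powr (2 / r))"
    using assms(1) by (intro mult_left_mono) auto
  then show ?thesis by (simp add: mult_ac)
qed

section \<open>Decay of the gap along the restarts\<close>

text \<open>The hypothesis \<open>\<rho> * \<tau> \<le> \<sigma>\<close> makes the growth of the schedule compensate the loss
  from the exponent \<open>1 - \<tau>\<close>; a schedule growing faster than necessary does no harm.\<close>

lemma restart_gap_decay:
  fixes g t :: "nat \<Rightarrow> real"
  assumes nonneg: "\<And>k. 0 \<le> g k" and g0: "0 < g 0"
    and step: "\<And>k. g (Suc k) \<le> B * g k powr (1 - \<tau>) / (t (Suc k))\<^sup>2"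
    and t: "\<And>k. t k = T * exp (\<sigma> * real k)"
    and T: "0 < T" "0 < D" "exp (1 - \<tau>) * D \<le> T" "B = D\<^sup>2 * g 0 powr \<tau>"
    and \<tau>: "\<tau> < 1" and \<rho>: "0 \<le> \<rho>" "\<rho> \<le> 1" "\<rho> * \<tau> \<le> \<sigma>"
  shows "g k \<le> exp (- 2 * \<rho> * real k) * g 0"
proof (induction k)
  case 0
  then show ?case by simp
next
  case (Suc k)
  have "exp (\<rho> * (1 - \<tau>)) * D \<le> T"
  proof -
    have "\<rho> * (1 - \<tau>) \<le> 1 * (1 - \<tau>)" using \<tau> \<rho> by (intro mult_right_mono) auto
    then have "exp (\<rho> * (1 - \<tau>)) * D \<le> exp (1 - \<tau>) * D" using T by simp
    also have "\<dots> \<le> T" by (rule T)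
    finally show ?thesis .
  qed
  \<comment> \<open>The constant part of the exponent is covered by the factor
    \<open>exp (1 - \<tau>)\<close> in \<open>T\<close>, the part growing with \<open>k\<close> by
    \<open>\<rho> * \<tau> \<le> \<sigma>\<close>.\<close>
  then have "exp (\<rho> * (1 - \<tau>)) * D * exp (\<rho> * \<tau> * real (Suc k)) \<le> T * exp (\<sigma> * real (Suc k))"
    using T \<rho> by (intro mult_mono iffD2[OF exp_le_cancel_iff] mult_right_mono) auto
  then have "exp (\<rho> * (1 - \<tau>) + \<rho> * \<tau> * real (Suc k)) * D \<le> t (Suc k)"
    unfolding t exp_add by (simp add: mult_ac)
  then have "(exp (\<rho> * (1 - \<tau>) + \<rho> * \<tau> * real (Suc k)) * D)\<^sup>2 \<le> (t (Suc k))\<^sup>2"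
    using T by (intro power_mono) auto
  then have tk: "exp (2 * (\<rho> * (1 - \<tau>) + \<rho> * \<tau> * real (Suc k))) * D\<^sup>2 \<le> (t (Suc k))\<^sup>2"
    by (simp only: exp_double power_mult_distrib)
  have "g (Suc k) \<le> B * g k powr (1 - \<tau>) / (t (Suc k))\<^sup>2" by (rule step)
  also have "\<dots> \<le> B * (exp (- 2 * \<rho> * real k) * g 0) powr (1 - \<tau>) / (t (Suc k))\<^sup>2"
    using T Suc nonneg[of k] \<tau>
    by (intro divide_right_mono mult_left_mono powr_mono2) auto
  also have "\<dots> \<le> B * (exp (- 2 * \<rho> * real k) * g 0) powr (1 - \<tau>) /
      (exp (2 * (\<rho> * (1 - \<tau>) + \<rho> * \<tau> * real (Suc k))) * D\<^sup>2)"
    using tk T g0 by (intro divide_left_mono mult_pos_pos) (auto simp: t)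
  also have "\<dots> = exp (- 2 * \<rho> * real k * (1 - \<tau>)) /
      exp (2 * (\<rho> * (1 - \<tau>) + \<rho> * \<tau> * real (Suc k))) * (g 0 powr \<tau> * g 0 powr (1 - \<tau>))"
    using T g0 by (simp add: powr_mult exp_powr_real)
  also have "g 0 powr \<tau> * g 0 powr (1 - \<tau>) = g 0"
    using g0 by (simp flip: powr_add)
  \<comment> \<open>The exponents add up since
    \<open>k * (1 - \<tau>) + (1 - \<tau>) + \<tau> * (k + 1) = k + 1\<close>.\<close>
  also have "exp (- 2 * \<rho> * real k * (1 - \<tau>)) /
      exp (2 * (\<rho> * (1 - \<tau>) + \<rho> * \<tau> * real (Suc k))) = exp (- 2 * \<rho> * real (Suc k))"
    unfolding exp_diff[symmetric] by (rule arg_cong[of _ _ exp]) (simp add: algebra_simps)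
  finally show ?case .
qed

section \<open>Geometric schedules and their stopping index\<close>

lemma grid_schedule_eq:
  "grid_schedule i j = oracle_schedule (2 ^ i) (if j = 0 then 0 else 2 powr - real j)"
  by (auto simp: fun_eq_iff grid_schedule_def oracle_schedule_def)

text \<open>This is the geometric sum, multiplied out by \<open>exp \<sigma> - 1\<close> so that the
  constant schedule \<open>\<sigma> = 0\<close> is included.\<close>

lemma oracle_schedule_partial_sum:
  "oracle_schedule T \<sigma> (Suc m) = T * exp \<sigma> + (exp \<sigma> - 1) * (\<Sum>k=1..m. oracle_schedule T \<sigma> k)"
proof (induction m)
  case 0
  then show ?case by (simp add: oracle_schedule_def)
next
  case (Suc m)
  have "oracle_schedule T \<sigma> (Suc (Suc m)) = exp \<sigma> * oracle_schedule T \<sigma> (Suc m)"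
    by (simp add: oracle_schedule_def algebra_simps flip: exp_add)
  then show ?case using Suc by (simp add: algebra_simps)
qed

lemma oracle_schedule_ge: "0 \<le> T \<Longrightarrow> 0 \<le> \<sigma> \<Longrightarrow> T \<le> oracle_schedule T \<sigma> k"
  by (simp add: oracle_schedule_def mult_le_cancel_left1)

text \<open>The \<open>LEAST\<close> in \<open>stop_index\<close> is meaningful only if some partial
  sum reaches \<open>N\<close>; the sums are unbounded because every term is at least
  \<open>T\<close>.\<close>

lemma inner_iterations_ge:
  assumes "0 < T" "0 \<le> \<sigma>"
  shows "N \<le> inner_iterations (oracle_schedule T \<sigma>) N"
  unfolding inner_iterations_def stop_index_def
proof (rule LeastI_ex)
  obtain R :: nat where "N / T \<le> real R" using real_arch_simple by blast
  then have "N \<le> (\<Sum>k=1..R. T)" using assms by (simp add: field_simps)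
  also have "\<dots> \<le> (\<Sum>k=1..R. oracle_schedule T \<sigma> k)"
    using assms by (intro sum_mono oracle_schedule_ge) auto
  finally show "\<exists>R. N \<le> (\<Sum>k=1..R. oracle_schedule T \<sigma> k)" by blast
qed

lemma stop_index_Suc:
  assumes "0 < T" "0 \<le> \<sigma>" "0 < N"
  obtains m where "stop_index (oracle_schedule T \<sigma>) N = Suc m"
    and "(\<Sum>k=1..m. oracle_schedule T \<sigma> k) < N"
proof (cases "stop_index (oracle_schedule T \<sigma>) N")
  case 0
  then show ?thesis
    using inner_iterations_ge[OF assms(1,2), of N] assms(3) by (simp add: inner_iterations_def)
next
  case (Suc m)
  have "\<not> N \<le> (\<Sum>k=1..m. oracle_schedule T \<sigma> k)"
    by (rule not_less_Least[where P = "\<lambda>R. N \<le> (\<Sum>k=1..R. oracle_schedule T \<sigma> k)"])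
       (use Suc in \<open>simp add: stop_index_def\<close>)
  then show ?thesis using that Suc by simp
qed

text \<open>Fewer than \<open>N\<close> iterations precede the last restart, whose own cost follows
  from the sum formula. For \<open>\<sigma> \<le> 1\<close>,
  \<open>exp \<sigma> - 1 \<le> 2 * \<sigma>\<close> and
  \<open>exp \<sigma> \<le> 3\<close>.\<close>

lemma inner_iterations_le:
  assumes "0 < T" "0 \<le> \<sigma>" "\<sigma> \<le> 1" "0 < N"
  shows "inner_iterations (oracle_schedule T \<sigma>) N \<le> N + 2 * \<sigma> * N + 3 * T"
proof -
  obtain m where m: "stop_index (oracle_schedule T \<sigma>) N = Suc m"
      "(\<Sum>k=1..m. oracle_schedule T \<sigma> k) < N" (is "?S < N")
    using stop_index_Suc[OF assms(1,2,4)] by blast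
  have "exp \<sigma> \<le> 1 + \<sigma> + \<sigma>\<^sup>2" using assms by (intro exp_bound) auto
  moreover have "\<sigma>\<^sup>2 \<le> \<sigma>" using assms by (simp add: power2_eq_square mult_left_le)
  ultimately have e: "exp \<sigma> - 1 \<le> 2 * \<sigma>" by simp
  have "0 \<le> ?S" using assms by (intro sum_nonneg) (simp add: oracle_schedule_def)
  have "inner_iterations (oracle_schedule T \<sigma>) N
      = ?S + (T * exp \<sigma> + (exp \<sigma> - 1) * ?S)"
    unfolding inner_iterations_def m(1) by (simp add: oracle_schedule_partial_sum)
  also have "\<dots> \<le> N + (T * 3 + 2 * \<sigma> * N)"
    using e m(2) assms \<open>0 \<le> ?S\<close> by (intro add_mono mult_mono) auto
  finally show ?thesis by simp
qed

text \<open>The first bound replaces every term by the last and suits nearly constant schedules; the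
  second uses the sum formula with \<open>\<sigma> \<le> exp \<sigma> - 1\<close> and suits growing
  ones.\<close>

lemma stop_index_lower_bounds:
  assumes "0 < T" "0 \<le> \<sigma>" "R = stop_index (oracle_schedule T \<sigma>) N"
  shows "N \<le> real R * (T * exp (\<sigma> * real R))"
    and "\<sigma> * N \<le> T * exp \<sigma> * (exp (\<sigma> * real R) - 1)"
proof -
  let ?S = "\<Sum>k=1..R. oracle_schedule T \<sigma> k"
  have N: "N \<le> ?S"
    using inner_iterations_ge[OF assms(1,2)] by (simp add: inner_iterations_def assms(3))
  have "?S \<le> (\<Sum>k=1..R. T * exp (\<sigma> * real R))"
    using assms(1,2) by (intro sum_mono) (auto simp: oracle_schedule_def intro: mult_left_mono)
  with N show "N \<le> real R * (T * exp (\<sigma> * real R))" by simp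
  have "0 \<le> ?S" using assms(1) by (intro sum_nonneg) (simp add: oracle_schedule_def)
  have "\<sigma> * N \<le> \<sigma> * ?S" using N assms(2) by (rule mult_left_mono)
  also have "\<dots> \<le> (exp \<sigma> - 1) * ?S"
    using \<open>0 \<le> ?S\<close> exp_ge_add_one_self[of \<sigma>] by (intro mult_right_mono) linarith+
  also have "\<dots> = oracle_schedule T \<sigma> (Suc R) - T * exp \<sigma>"
    by (simp add: oracle_schedule_partial_sum)
  also have "\<dots> = T * exp \<sigma> * (exp (\<sigma> * real R) - 1)"
    by (simp add: oracle_schedule_def algebra_simps exp_add)
  finally show "\<sigma> * N \<le> T * exp \<sigma> * (exp (\<sigma> * real R) - 1)" .
qed

text \<open>With \<open>T \<ge> 4\<close> and \<open>N \<ge> 4\<close> there are at most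
  \<open>N / 2\<close> restarts, so the exponent \<open>\<sigma> * k\<close> never exceeds
  \<open>1 / 2\<close> and the schedule grows by less than a factor 2.\<close>

lemma stop_index_flat_schedule:
  assumes "4 \<le> T" "0 \<le> \<sigma>" "\<sigma> \<le> 1 / N" "4 \<le> N"
  shows "N \<le> 2 * T * real (stop_index (oracle_schedule T \<sigma>) N)"
proof -
  obtain m where m: "stop_index (oracle_schedule T \<sigma>) N = Suc m"
      "(\<Sum>k=1..m. oracle_schedule T \<sigma> k) < N"
    using stop_index_Suc[of T \<sigma> N] assms by force
  have "real m * 4 \<le> real m * T" using assms(1) by (intro mult_left_mono) auto
  also have "\<dots> = (\<Sum>k=1..m. T)" by simp
  also have "\<dots> \<le> (\<Sum>k=1..m. oracle_schedule T \<sigma> k)"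
    using assms by (intro sum_mono oracle_schedule_ge) auto
  finally have "real (Suc m) \<le> N / 2" using m(2) assms(4) by simp
  then have "\<sigma> * real (Suc m) \<le> 1 / N * (N / 2)"
    using assms by (intro mult_mono) auto
  then have half: "\<sigma> * real (Suc m) \<le> 1 / 2" using assms(4) by simp
  have "exp (\<sigma> * real (Suc m)) \<le> exp (1 / 2)" using half by simp
  also have "exp (1 / 2 :: real) \<le> 1 + 1 / 2 + (1 / 2)\<^sup>2" by (intro exp_bound) auto
  finally have "exp (\<sigma> * real (Suc m)) \<le> 2" by (simp add: power2_eq_square)
  have "N \<le> real (Suc m) * (T * exp (\<sigma> * real (Suc m)))"
    using assms by (intro stop_index_lower_bounds(1)) (auto simp: m(1))
  also have "\<dots> \<le> real (Suc m) * (T * 2)"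
    using \<open>exp (\<sigma> * real (Suc m)) \<le> 2\<close> assms(1) by (intro mult_left_mono) auto
  finally show ?thesis unfolding m(1) by (simp only: mult_ac)
qed

section \<open>Choice of the grid point\<close>

text \<open>Rounding \<open>log 2 C\<close> up works: \<open>1 < C\<close> gives an index at least
  1, and \<open>2 * C \<le> N\<close> leaves room for the rounding.\<close>

lemma grid_i_exists:
  assumes "1 < C" "2 * C \<le> N"
  obtains i where "i \<in> grid_i N" "C \<le> 2 ^ i" "2 ^ i \<le> 2 * C"
proof -
  define i where "i = nat \<lceil>log 2 C\<rceil>"
  have pos: "0 < log 2 C" using assms by simp
  then have i: "log 2 C \<le> real i" "real i < log 2 C + 1" "1 \<le> i"
    unfolding i_def by linarith+
  have "log 2 (2 * C) \<le> log 2 N" using assms by simp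
  then have "log 2 C + 1 \<le> log 2 N" using assms by (simp add: log_mult)
  then have "i \<in> grid_i N"
    using i by (simp add: grid_i_def le_nat_iff le_floor_iff)
  moreover have "2 powr log 2 C \<le> 2 powr real i" "2 powr real i \<le> 2 powr (log 2 C + 1)"
    using i by (intro powr_mono; simp)+
  then have "C \<le> 2 ^ i" "2 ^ i \<le> 2 * C"
    using assms by (simp_all add: powr_realpow powr_add)
  ultimately show ?thesis using that by blast
qed

lemma grid_j_exists:
  fixes \<tau> :: real
  assumes "0 < \<tau>" "\<tau> < 1" "1 < N"
  obtains (match) j where "j \<in> grid_j N" "j \<noteq> 0" "2 powr - real j \<le> \<tau>" "\<tau> \<le> 2 * 2 powr - real j"
  | (flat) j where "j \<in> grid_j N" "j \<noteq> 0" "\<tau> \<le> 2 powr - real j" "2 powr - real j \<le> 1 / N"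
proof -
  define j where "j = nat \<lceil>- log 2 \<tau>\<rceil>"
  define J where "J = nat \<lceil>log 2 N\<rceil>"
  have "log 2 \<tau> < 0" "0 < log 2 N" using assms by simp_all
  then have j: "- log 2 \<tau> \<le> real j" "real j < - log 2 \<tau> + 1" "j \<noteq> 0"
    and J: "log 2 N \<le> real J" "J \<noteq> 0"
    unfolding j_def J_def by linarith+
  have \<tau>: "\<tau> = 2 powr log 2 \<tau>" using assms by simp
  show ?thesis
  proof (cases "j \<le> J")
    case True
    have "2 powr - real j \<le> 2 powr log 2 \<tau>" "2 powr log 2 \<tau> \<le> 2 powr (1 - real j)"
      using j by (intro powr_mono; simp)+
    moreover have "2 powr (1 - real j) = 2 * 2 powr - real j"
      by (simp add: powr_diff powr_minus divide_inverse)
    ultimately show ?thesis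
      using match[of j] True j(3) \<tau> by (simp add: grid_j_def J_def)
  next
    case False
    \<comment> \<open>The wanted index lies beyond the grid, so its last index \<open>J\<close> is
      taken: \<open>J + 1 \<le> j\<close> and the rounding in \<open>j\<close> give
      \<open>\<tau> \<le> 2 powr - J\<close>.\<close>
    then have "real J + 1 \<le> real j" by simp
    with j have "real J \<le> - log 2 \<tau>" by linarith
    then have "2 powr log 2 \<tau> \<le> 2 powr - real J" by (intro powr_mono) auto
    moreover have "2 powr - real J \<le> 2 powr - log 2 N"
      using J by (intro powr_mono) auto
    then have "2 powr - real J \<le> 1 / N"
      using assms by (simp add: powr_minus_divide)
    ultimately show ?thesis
      using flat[of J] J(2) \<tau> by (simp add: grid_j_def J_def)
  qed
qed

section \<open>Cost of the grid search\<close>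

text \<open>Every run costs at least \<open>n\<close>, and there are at least
  \<open>(l - 1) * (l + 1)\<close> runs for \<open>l = log 2 n\<close>. In the upper bound each
  geometric overshoot is summed along its own index and multiplied by the number of values of the
  other.\<close>

lemma grid_search_cost_bounds:
  assumes "2 \<le> n"
  shows "((log 2 n)\<^sup>2 - 1) * n \<le> grid_search_cost n"
    and "grid_search_cost n \<le> ((log 2 n)\<^sup>2 + 12 * log 2 n + 12) * n"
proof -
  define l where "l = log 2 n"
  define I where "I = nat \<lfloor>l\<rfloor>"
  define J where "J = nat \<lceil>l\<rceil>"
  define \<sigma> where "\<sigma> j = (if j = 0 then 0 else 2 powr - real j)" for j :: nat
  have l: "1 \<le> l" using assms by (simp add: l_def)
  then have I: "l - 1 \<le> real I" "real I \<le> l" and J: "l \<le> real J" "real J \<le> l + 1"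
    unfolding I_def J_def by linarith+
  have \<sigma>: "0 \<le> \<sigma> j" "\<sigma> j \<le> (1 / 2) ^ j" for j
    by (simp_all add: \<sigma>_def powr_minus powr_realpow power_one_over inverse_eq_divide)
  have \<sigma>1: "\<sigma> j \<le> 1" for j
    using \<sigma>(2)[of j] by (rule order_trans) (simp add: power_le_one)
  have cost: "grid_search_cost n
      = (\<Sum>i\<in>{1..I}. \<Sum>j\<in>{..J}. inner_iterations (oracle_schedule (2 ^ i) (\<sigma> j)) n)"
    by (simp add: grid_search_cost_def grid_i_def grid_j_def grid_schedule_eq \<sigma>_def
        I_def J_def l_def atLeast0AtMost)
  have "n * (l - 1) * (l + 1) \<le> n * real I * (real J + 1)"
    using l I J assms by (intro mult_mono) auto
  also have "\<dots> = (\<Sum>i\<in>{1..I}. \<Sum>j\<in>{..J}. n)" by simp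
  also have "\<dots> \<le> grid_search_cost n"
    unfolding cost using \<sigma> by (intro sum_mono inner_iterations_ge) auto
  finally show "((log 2 n)\<^sup>2 - 1) * n \<le> grid_search_cost n"
    unfolding l_def by (simp add: algebra_simps power2_eq_square)
  have half: "(\<Sum>j\<in>{..J}. (1 / 2 :: real) ^ j) \<le> 2"
    by (simp add: sum_gp0)
  have "2 ^ I = 2 powr real I" by (simp add: powr_realpow)
  also have "\<dots> \<le> 2 powr l" using I by (intro powr_mono) auto
  also have "\<dots> = n" using assms by (simp add: l_def)
  finally have "2 ^ I \<le> n" .
  have two: "(\<Sum>i\<in>{1..I}. (2 :: real) ^ i) \<le> 2 * n"
  proof -
    have "(\<Sum>i\<in>{1..I}. (2 :: real) ^ i) \<le> (\<Sum>i\<in>{..I}. 2 ^ i)"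
      by (intro sum_mono2) auto
    also have "\<dots> \<le> 2 * 2 ^ I" by (simp add: sum_gp0)
    finally show ?thesis using \<open>2 ^ I \<le> n\<close> by simp
  qed
  have "grid_search_cost n
      \<le> (\<Sum>i\<in>{1..I}. \<Sum>j\<in>{..J}. n + 2 * \<sigma> j * n + 3 * 2 ^ i)"
    unfolding cost using \<sigma> \<sigma>1 assms by (intro sum_mono inner_iterations_le) auto
  also have "\<dots> \<le> (\<Sum>i\<in>{1..I}. \<Sum>j\<in>{..J}. n + 2 * n * (1 / 2) ^ j + 3 * 2 ^ i)"
    using \<sigma>(2) assms by (intro sum_mono) (simp add: mult_ac)
  also have "\<dots> = n * real I * (real J + 1) + 2 * n * real I * (\<Sum>j\<in>{..J}. (1 / 2) ^ j)
      + 3 * (real J + 1) * (\<Sum>i\<in>{1..I}. 2 ^ i)"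
  proof -
    have "(\<Sum>j\<in>{..J}. n + 2 * n * (1 / 2) ^ j + 3 * 2 ^ i)
        = n * (real J + 1) + 2 * n * (\<Sum>j\<in>{..J}. (1 / 2) ^ j) + 3 * (real J + 1) * 2 ^ i" for i
      by (simp add: sum.distrib sum_distrib_left, simp add: algebra_simps)
    then show ?thesis
      by (simp only: sum.distrib flip: sum_distrib_left) (simp add: algebra_simps)
  qed
  also have "\<dots> \<le> n * l * (l + 2) + 2 * n * l * 2 + 3 * (l + 2) * (2 * n)"
  proof -
    have "real J + 1 \<le> l + 2" using J by simp
    then have "n * real I * (real J + 1) \<le> n * l * (l + 2)"
      and "2 * n * real I * (\<Sum>j\<in>{..J}. (1 / 2) ^ j) \<le> 2 * n * l * 2"
      and "3 * (real J + 1) * (\<Sum>i\<in>{1..I}. 2 ^ i) \<le> 3 * (l + 2) * (2 * n)"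
      using I l half two assms by (intro mult_mono; auto intro: sum_nonneg)+
    then show ?thesis by linarith
  qed
  finally show "grid_search_cost n \<le> ((log 2 n)\<^sup>2 + 12 * log 2 n + 12) * n"
    unfolding l_def by (simp add: algebra_simps power2_eq_square)
qed

lemma grid_search_cost_asymp_equiv: "grid_search_cost \<sim>[at_top] (\<lambda>n. (log 2 n)\<^sup>2 * n)"
proof (rule asymp_equiv_sandwich_real)
  have log: "filterlim (log 2) at_top at_top"
    by real_asymp
  have "(\<lambda>l :: real. l\<^sup>2 - 1) \<sim>[at_top] (\<lambda>l. l\<^sup>2)"
    and "(\<lambda>l :: real. l\<^sup>2 + 12 * l + 12) \<sim>[at_top] (\<lambda>l. l\<^sup>2)"
    by real_asymp+
  note equiv = this[THEN asymp_equiv_compose', OF log]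
  show "(\<lambda>n. ((log 2 n)\<^sup>2 - 1) * n) \<sim>[at_top] (\<lambda>n. (log 2 n)\<^sup>2 * n)"
    and "(\<lambda>n. ((log 2 n)\<^sup>2 + 12 * log 2 n + 12) * n) \<sim>[at_top] (\<lambda>n. (log 2 n)\<^sup>2 * n)"
    by (intro asymp_equiv_mult asymp_equiv_refl equiv)+
  show "eventually (\<lambda>n. grid_search_cost n \<in> {((log 2 n)\<^sup>2 - 1) * n..
      ((log 2 n)\<^sup>2 + 12 * log 2 n + 12) * n}) at_top"
    using eventually_ge_at_top[of 2]
    by eventually_elim (simp only: atLeastAtMost_iff grid_search_cost_bounds simp_thms)
qed

text \<open>Once \<open>n \<ge> T\<close>, the overshoot bound gives the constant
  \<open>6 = 1 + 2 + 3\<close>. This lets the cost of the oracle run stand in for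
  \<open>n\<close>.\<close>

lemma inner_iterations_bigtheta:
  assumes "0 < T" "0 \<le> \<sigma>" "\<sigma> \<le> 1"
  shows "inner_iterations (oracle_schedule T \<sigma>) \<in> \<Theta>[at_top](\<lambda>n. n)"
proof (rule bigthetaI)
  have "eventually (\<lambda>n. norm (inner_iterations (oracle_schedule T \<sigma>) n) \<le> 6 * norm n) at_top"
    using eventually_ge_at_top[of T] eventually_gt_at_top[of 0]
  proof eventually_elim
    case (elim n)
    have "2 * \<sigma> * n \<le> 2 * n" using assms elim by (simp add: mult_left_le_one_le)
    then have "inner_iterations (oracle_schedule T \<sigma>) n \<le> 6 * n"
      using inner_iterations_le[OF assms, of n] elim by linarith
    then show ?case using inner_iterations_ge[OF assms(1,2), of n] elim by simp
  qed
  then show "inner_iterations (oracle_schedule T \<sigma>) \<in> O(\<lambda>n. n)" by (rule bigoI)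
  have "eventually (\<lambda>n. norm n \<le> 1 * norm (inner_iterations (oracle_schedule T \<sigma>) n)) at_top"
    using eventually_gt_at_top[of 0]
  proof eventually_elim
    case (elim n)
    then show ?case using inner_iterations_ge[OF assms(1,2), of n] by simp
  qed
  then show "inner_iterations (oracle_schedule T \<sigma>) \<in> \<Omega>(\<lambda>n. n)"
    unfolding bigomega_iff_bigo by (rule bigoI)
qed

section \<open>From the guarantee of the method to the two rates\<close>

lemma restart_precision:
  fixes f :: "real ^ 'n \<Rightarrow> real"
  assumes "0 < L" "0 < \<mu>" "2 \<le> r" "minimizers f \<noteq> {}" "min_value f < f x0"
    and loj: "f \<in> lojasiewicz_class r \<mu> {x. f x \<le> f x0}"
    and A: "monotone_accelerated_method L f A"
    and \<tau>: "\<tau> = 1 - 2 / r"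
    and B: "4 * exp (2 / exp 1) * (L / \<mu> powr (2 / r)) = D\<^sup>2 * (f x0 - min_value f) powr \<tau>"
    and D: "0 < D" "exp (1 - \<tau>) * D \<le> T"
    and \<rho>: "0 \<le> \<sigma>" "0 \<le> \<rho>" "\<rho> \<le> 1" "\<rho> * \<tau> \<le> \<sigma>"
  shows "f (restart A (oracle_schedule T \<sigma>) x0 k) - min_value f
    \<le> exp (- 2 * \<rho> * real k) * (f x0 - min_value f)"
proof -
  define x where "x = restart A (oracle_schedule T \<sigma>) x0"
  have T: "0 < T" using D by (smt (verit) exp_gt_zero mult_pos_pos)
  then have t: "0 < oracle_schedule T \<sigma> k" for k by (simp add: oracle_schedule_def)
  \<comment> \<open>Monotonicity keeps all iterates in the sublevel set, the only place where growth
    is assumed.\<close>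
  have in_K: "f (x k) \<le> f x0" for k
  proof (induction k)
    case (Suc k)
    then show ?case
      using A t by (fastforce simp: x_def monotone_accelerated_method_def intro: order_trans)
  qed (simp add: x_def)
  have "f (x (Suc k)) - min_value f \<le> 4 * exp (2 / exp 1) * (L / \<mu> powr (2 / r)) *
      (f (x k) - min_value f) powr (1 - \<tau>) / (oracle_schedule T \<sigma> (Suc k))\<^sup>2" for k
  proof -
    have "f (x (Suc k)) - min_value f
        \<le> 4 * L / (oracle_schedule T \<sigma> (Suc k))\<^sup>2 * (infdist (x k) (minimizers f))\<^sup>2"
      using A t by (simp add: x_def monotone_accelerated_method_def)
    also have "\<dots> = 4 * (L * (infdist (x k) (minimizers f))\<^sup>2) / (oracle_schedule T \<sigma> (Suc k))\<^sup>2"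
      by simp
    also have "\<dots> \<le> 4 * (exp (2 / exp 1) * (L / \<mu> powr (2 / r)) *
        (f (x k) - min_value f) powr (2 / r)) / (oracle_schedule T \<sigma> (Suc k))\<^sup>2"
      using assms(1-3) in_K
      by (intro divide_right_mono mult_left_mono lojasiewicz_infdist_le[OF _ _ _ loj]) auto
    finally show ?thesis by (simp add: \<tau> mult_ac)
  qed
  from this[unfolded B] have "f (x k) - min_value f
      \<le> exp (- 2 * \<rho> * real k) * (f (x 0) - min_value f)"
    using T D \<rho> \<tau> assms(3,5) min_value_le[OF assms(4)]
    by (intro restart_gap_decay[where t = "oracle_schedule T \<sigma>" and \<tau> = \<tau>])
       (auto simp: x_def oracle_schedule_def)
  then show ?thesis by (simp add: x_def)
qed

text \<open>Smoothness bounds the gap at \<open>x0\<close> above by the squared distance, growth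
  bounds that by a power of the gap. The result is what yields \<open>2 \<le> D\<close> in the
  theorem.\<close>

lemma gap_powr_le:
  fixes f :: "real ^ 'n \<Rightarrow> real"
  assumes "0 < L" "0 < \<mu>" "1 \<le> r" "convex_on UNIV f" "minimizers f \<noteq> {}"
    and "min_value f < f x0"
    and "f \<in> smooth_class L" "f \<in> lojasiewicz_class r \<mu> {x. f x \<le> f x0}"
  shows "(f x0 - min_value f) powr (1 - 2 / r) \<le> exp (2 / exp 1) * (L / \<mu> powr (2 / r))"
proof -
  define \<delta> where "\<delta> = f x0 - min_value f"
  have \<delta>: "0 < \<delta>" using assms(6) by (simp add: \<delta>_def)
  have "\<delta> \<le> L * (infdist x0 (minimizers f))\<^sup>2"
    unfolding \<delta>_def by (rule smooth_gap_le[OF assms(1,4,5,7)])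
  also have "\<dots> \<le> exp (2 / exp 1) * (L / \<mu> powr (2 / r)) * \<delta> powr (2 / r)"
    unfolding \<delta>_def by (rule lojasiewicz_infdist_le[OF assms(1-3,8)]) simp
  finally have "\<delta> / \<delta> powr (2 / r) \<le> exp (2 / exp 1) * (L / \<mu> powr (2 / r))"
    using \<delta> by (simp add: divide_le_eq)
  then show ?thesis
    using \<delta> by (simp add: powr_diff flip: \<delta>_def)
qed

theorem proposition2p4:
  fixes f :: "real ^ 'n \<Rightarrow> real"
    and A :: "real ^ 'n \<Rightarrow> real \<Rightarrow> real ^ 'n"
    and x0 :: "real ^ 'n"
    and L \<mu> r \<kappa> \<tau> c C N :: real
  assumes "0 < L" and "0 < \<mu>" and "1 \<le> r"
    and "convex_on UNIV f"
    and "minimizers f \<noteq> {}"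
    and "min_value f < f x0"
    and "f \<in> smooth_class L \<inter> lojasiewicz_class r \<mu> {x. f x \<le> f x0}"
    and "monotone_accelerated_method L f A"
    and "\<kappa> = L / \<mu> powr (2 / r)"
    and "\<tau> = 1 - 2 / r"
    and "c = 4 * exp (2 / exp 1)"
    and "C = exp (1 - \<tau>) * (c * \<kappa>) powr (1 / 2) * (f x0 - min_value f) powr (- \<tau> / 2)"
    and "2 * C \<le> N"
  shows "\<tau> \<in> {0..<1} \<and>
    (\<tau> = 0 \<longrightarrow>
      (\<exists>i \<in> grid_i N.
         f (restart_output A (grid_schedule i 0) x0 N) - min_value f
           \<le> exp (- exp (- 1) * (c * \<kappa>) powr (- 1 / 2) * N) * (f x0 - min_value f))) \<and>
    (0 < \<tau> \<longrightarrow>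
      (\<exists>i \<in> grid_i N. \<exists>j \<in> grid_j N.
         f (restart_output A (grid_schedule i j) x0 N) - min_value f
           \<le> (f x0 - min_value f) /
             (\<tau> * exp (- 1) * (c * \<kappa>) powr (- 1 / 2) * (f x0 - min_value f) powr (\<tau> / 2)
                * (N - 1) / 4 + 1) powr (2 / \<tau>))) \<and>
    grid_search_cost \<sim>[at_top] (\<lambda>n. (log 2 n)\<^sup>2 * n) \<and>
    grid_search_cost \<in>
      \<Theta>[at_top](\<lambda>n. (log 2 n)\<^sup>2 * inner_iterations (oracle_schedule C \<tau>) n)"
proof -
  define \<delta> where "\<delta> = f x0 - min_value f"
  define D where "D = (c * \<kappa>) powr (1 / 2) * \<delta> powr (- \<tau> / 2)"
  have smooth: "f \<in> smooth_class L" and loj: "f \<in> lojasiewicz_class r \<mu> {x. f x \<le> f x0}"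
    using assms(7) by auto
  have \<delta>: "0 < \<delta>" using assms(6) by (simp add: \<delta>_def)
  have r: "2 \<le> r"
    by (rule lojasiewicz_exponent_ge_2[OF assms(1-6) smooth loj])
  then have \<tau>: "0 \<le> \<tau>" "\<tau> < 1" by (auto simp: assms(10) field_simps)
  have c\<kappa>: "0 < c * \<kappa>" using assms by simp
  \<comment> \<open>\<open>D\<close> is normalized so that \<open>c * \<kappa>\<close>, the constant
    of the gap recursion, takes the form required by \<open>restart_precision\<close>.\<close>
  have D2: "c * \<kappa> = D\<^sup>2 * \<delta> powr \<tau>"
  proof -
    have "D\<^sup>2 = c * \<kappa> * \<delta> powr (- \<tau>)"
      unfolding D_def power_mult_distrib using c\<kappa> by (simp add: power2_eq_square flip: powr_add)
    then show ?thesis using \<delta> by (simp add: powr_minus)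
  qed
  have "0 < D" unfolding D_def using c\<kappa> \<delta> by (intro mult_pos_pos) auto
  have "\<delta> powr \<tau> \<le> exp (2 / exp 1) * \<kappa>"
    unfolding assms(9,10) \<delta>_def by (rule gap_powr_le[OF assms(1-6) smooth loj])
  then have "4 * \<delta> powr \<tau> \<le> 4 * (exp (2 / exp 1) * \<kappa>)"
    by (rule mult_left_mono) simp
  then have "2\<^sup>2 * \<delta> powr \<tau> \<le> c * \<kappa>"
    by (simp only: assms(11) mult.assoc power2_eq_square numeral_times_numeral semiring_norm)
  then have "2\<^sup>2 \<le> D\<^sup>2" using \<delta> by (simp add: D2)
  then have "2 \<le> D" by (rule power2_le_imp_le) (use \<open>0 < D\<close> in simp)
  have inv_D: "(c * \<kappa>) powr (- 1 / 2) * \<delta> powr (\<tau> / 2) = 1 / D"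
    using c\<kappa> \<delta> by (simp add: D_def powr_minus field_simps)
  have C: "C = exp (1 - \<tau>) * D" by (simp add: assms(12) D_def \<delta>_def)
  have "1 < exp (1 - \<tau>)" using \<tau> by simp
  then have "1 * 2 < exp (1 - \<tau>) * D" using \<open>2 \<le> D\<close> by (intro mult_less_le_imp_less) auto
  then have "2 < C" by (simp add: C)
  then have N: "4 < N" using assms(13) by linarith
  obtain i where i: "i \<in> grid_i N" "C \<le> 2 ^ i" "2 ^ i \<le> 2 * C"
    using grid_i_exists[of C N] \<open>2 < C\<close> assms(13) by auto
  \<comment> \<open>A power of two above 2 is at least 4, as \<open>stop_index_flat_schedule\<close>
    requires.\<close>
  have "4 \<le> (2 :: real) ^ i"
  proof -
    have "(2 :: real) ^ 1 < 2 ^ i" using i(2) \<open>2 < C\<close> by simp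
    then have "2 \<le> i" using power_less_imp_less_exp[of "2 :: real" 1 i] by simp
    then have "(2 :: real) ^ 2 \<le> 2 ^ i" by (intro power_increasing) auto
    then show ?thesis by simp
  qed
  define R where "R \<sigma> = stop_index (oracle_schedule (2 ^ i) \<sigma>) N" for \<sigma>
  have precision: "f (restart_output A (oracle_schedule (2 ^ i) \<sigma>) x0 N) - min_value f
      \<le> exp (- 2 * \<rho> * real (R \<sigma>)) * \<delta>"
    if "0 \<le> \<sigma>" "0 \<le> \<rho>" "\<rho> \<le> 1" "\<rho> * \<tau> \<le> \<sigma>" for \<sigma> \<rho>
    unfolding restart_output_def R_def \<delta>_def using i(2) D2 that
    by (intro restart_precision[OF assms(1,2) r assms(5,6) loj assms(8,10) _ \<open>0 < D\<close>])
       (auto simp: C assms(9,11) \<delta>_def)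
  \<comment> \<open>The factor \<open>exp (1 - \<tau>)\<close> in \<open>C\<close> completes
    \<open>exp \<tau>\<close> to \<open>exp 1\<close>, the source of \<open>exp (- 1)\<close> in the
    rates; the 2 comes from rounding \<open>C\<close> up.\<close>
  have exp_D: "2 ^ i * exp \<tau> \<le> 2 * exp 1 * D"
  proof -
    have "2 ^ i * exp \<tau> \<le> 2 * C * exp \<tau>" using i(3) by simp
    also have "\<dots> = 2 * (exp (1 - \<tau>) * exp \<tau>) * D" by (simp add: C)
    also have "exp (1 - \<tau>) * exp \<tau> = exp 1" by (simp flip: exp_add)
    finally show ?thesis .
  qed

  have linear: "\<exists>i \<in> grid_i N. f (restart_output A (grid_schedule i 0) x0 N) - min_value f
      \<le> exp (- exp (- 1) * (c * \<kappa>) powr (- 1 / 2) * N) * \<delta>" if "\<tau> = 0"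
  proof (rule bexI[OF _ i(1)])
    have "N \<le> real (R 0) * 2 ^ i"
      using stop_index_lower_bounds(1)[of "2 ^ i" 0 "R 0" N] by (simp add: R_def)
    also have "\<dots> \<le> real (R 0) * (2 * exp 1 * D)"
      using exp_D that by (intro mult_left_mono) auto
    \<comment> \<open>The 2 lost by rounding \<open>C\<close> is absorbed by the 2 in the decay
      \<open>exp (- 2 * R)\<close>.\<close>
    finally have "N / (exp 1 * D) \<le> 2 * real (R 0)"
      using \<open>0 < D\<close> by (simp add: field_simps)
    then have "exp (- 2 * real (R 0)) * \<delta> \<le> exp (- (N / (exp 1 * D))) * \<delta>"
      using \<delta> by simp
    also have "N / (exp 1 * D) = exp (- 1) * (c * \<kappa>) powr (- 1 / 2) * N"
      using inv_D \<delta> that by (simp add: exp_minus field_simps)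
    finally show "f (restart_output A (grid_schedule i 0) x0 N) - min_value f
        \<le> exp (- exp (- 1) * (c * \<kappa>) powr (- 1 / 2) * N) * \<delta>"
      using precision[of 0 1] that by (simp add: grid_schedule_eq)
  qed

  \<comment> \<open>The divisor 4 covers the rounding of \<open>C\<close> and one further factor 2:
    the rounding of \<open>\<tau>\<close> if it is matched, the growth of the schedule if it is
    flat.\<close>
  define X where "X = \<tau> * exp (- 1) * (c * \<kappa>) powr (- 1 / 2) * \<delta> powr (\<tau> / 2) * (N - 1) / 4"
  have X: "X = \<tau> * (N - 1) / (4 * exp 1 * D)"
  proof -
    have "X = \<tau> * exp (- 1) * ((c * \<kappa>) powr (- 1 / 2) * \<delta> powr (\<tau> / 2)) * (N - 1) / 4"
      by (simp add: X_def mult_ac)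
    then show ?thesis unfolding inv_D by (simp add: exp_minus field_simps)
  qed
  have "0 \<le> X" using \<tau> N \<open>0 < D\<close> by (simp add: X)
  have sublinear: "\<exists>i \<in> grid_i N. \<exists>j \<in> grid_j N.
      f (restart_output A (grid_schedule i j) x0 N) - min_value f \<le> \<delta> / (X + 1) powr (2 / \<tau>)"
    if "0 < \<tau>"
  proof -
    \<comment> \<open>Raising \<open>X + 1 \<le> exp (\<rho> * \<tau> * R)\<close> to the power
      \<open>2 / \<tau>\<close> turns it into the decay \<open>exp (2 * \<rho> * R)\<close>, so each
      case only has to find \<open>\<rho>\<close>.\<close>
    have bound: ?thesis
      if j: "j \<in> grid_j N" "j \<noteq> 0" and \<sigma>: "\<sigma> = 2 powr - real j"
        and \<rho>: "0 \<le> \<rho>" "\<rho> \<le> 1" "\<rho> * \<tau> \<le> \<sigma>" "X + 1 \<le> exp (\<rho> * \<tau> * real (R \<sigma>))"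
      for j \<sigma> \<rho>
    proof (intro bexI[OF _ i(1)] bexI[OF _ j(1)])
      have "(X + 1) powr (2 / \<tau>) \<le> exp (\<rho> * \<tau> * real (R \<sigma>)) powr (2 / \<tau>)"
        using \<rho> \<open>0 \<le> X\<close> \<open>0 < \<tau>\<close> by (intro powr_mono2) auto
      also have "\<dots> = exp (2 * \<rho> * real (R \<sigma>))"
        using \<open>0 < \<tau>\<close> by (simp add: exp_powr_real mult_ac)
      finally have "\<delta> / exp (2 * \<rho> * real (R \<sigma>)) \<le> \<delta> / (X + 1) powr (2 / \<tau>)"
        using \<open>0 \<le> X\<close> \<delta> by (intro divide_left_mono mult_pos_pos) auto
      then show "f (restart_output A (grid_schedule i j) x0 N) - min_value f
          \<le> \<delta> / (X + 1) powr (2 / \<tau>)"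
        using precision[of \<sigma> \<rho>] \<rho> j(2)
        by (simp add: grid_schedule_eq \<sigma> exp_minus divide_inverse mult_ac)
    qed
    have "1 < N" using N by simp
    with \<open>0 < \<tau>\<close> \<tau>(2) show ?thesis
    proof (cases rule: grid_j_exists)
      case (match j)
      define \<sigma> where "\<sigma> = 2 powr - real j"
      have \<sigma>: "0 < \<sigma>" "\<sigma> \<le> \<tau>" "\<tau> \<le> 2 * \<sigma>" using match by (auto simp: \<sigma>_def)
      have "X \<le> \<sigma> * N / (2 * exp 1 * D)"
      proof -
        have "\<tau> * (N - 1) \<le> 2 * \<sigma> * N" using \<sigma> \<tau> N by (intro mult_mono) auto
        then have "X \<le> 2 * \<sigma> * N / (4 * exp 1 * D)"
          using \<open>0 < D\<close> unfolding X by (intro divide_right_mono) auto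
        then show ?thesis by (simp add: mult_ac)
      qed
      also have "\<dots> \<le> exp (\<sigma> * real (R \<sigma>)) - 1"
      proof -
        have "\<sigma> * N \<le> 2 ^ i * exp \<sigma> * (exp (\<sigma> * real (R \<sigma>)) - 1)"
          using \<sigma> by (intro stop_index_lower_bounds(2)) (auto simp: R_def)
        also have "\<dots> \<le> 2 ^ i * exp \<tau> * (exp (\<sigma> * real (R \<sigma>)) - 1)"
          using \<sigma> by (intro mult_right_mono mult_left_mono) auto
        also have "\<dots> \<le> 2 * exp 1 * D * (exp (\<sigma> * real (R \<sigma>)) - 1)"
          using \<sigma> exp_D by (intro mult_right_mono) auto
        finally show ?thesis using \<open>0 < D\<close> by (simp add: field_simps)
      qed
      finally show ?thesis
        using bound[OF match(1,2) \<sigma>_def, of "\<sigma> / \<tau>"] \<sigma> that by simp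
    next
      case (flat j)
      define \<sigma> where "\<sigma> = 2 powr - real j"
      have "N \<le> 2 * 2 ^ i * real (R \<sigma>)"
        unfolding R_def using \<open>4 \<le> 2 ^ i\<close> N flat
        by (intro stop_index_flat_schedule) (auto simp: \<sigma>_def)
      also have "\<dots> \<le> 2 * (2 * exp 1 * D) * real (R \<sigma>)"
      proof -
        have "2 ^ i * 1 \<le> 2 ^ i * exp \<tau>" using \<tau> by (intro mult_left_mono) auto
        also note exp_D
        finally have "2 ^ i \<le> 2 * exp 1 * D" by (simp only: mult_1_right)
        then show ?thesis by (intro mult_right_mono mult_left_mono) auto
      qed
      finally have "\<tau> * (N - 1) \<le> \<tau> * (4 * exp 1 * D * real (R \<sigma>))"
        using \<tau> by (intro mult_left_mono) auto
      then have "X \<le> \<tau> * real (R \<sigma>)"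
        using \<open>0 < D\<close> unfolding X by (simp add: field_simps)
      then have "X + 1 \<le> exp (1 * \<tau> * real (R \<sigma>))"
        using exp_ge_add_one_self[of "\<tau> * real (R \<sigma>)"] unfolding mult_1_left by linarith
      then show ?thesis
        using bound[OF flat(1,2) \<sigma>_def, of 1] flat by (simp add: \<sigma>_def)
    qed
  qed

  have "(\<lambda>n. (log 2 n)\<^sup>2 * n) \<in>
      \<Theta>[at_top](\<lambda>n. (log 2 n)\<^sup>2 * inner_iterations (oracle_schedule C \<tau>) n)"
    using inner_iterations_bigtheta[of C \<tau>] \<tau> \<open>2 < C\<close>
    by (intro landau_theta.mult bigtheta_refl) (simp_all add: bigtheta_sym)
  then have "grid_search_cost \<in>
      \<Theta>[at_top](\<lambda>n. (log 2 n)\<^sup>2 * inner_iterations (oracle_schedule C \<tau>) n)"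
    by (rule landau_theta.trans[OF asymp_equiv_imp_bigtheta[OF grid_search_cost_asymp_equiv]])
  with \<tau> linear sublinear grid_search_cost_asymp_equiv show ?thesis
    unfolding X_def \<delta>_def by (intro conjI impI) (simp_all only: atLeastLessThan_iff simp_thms)
qed

end
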